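(* Let $A\subset\mathbb{R}$ be a set of cardinality seven. Then $|A+A|\le |A-A|$.
   Context: For a finite set $A\subset\mathbb{R}$, $A+A=\{a+b:a,b\in A\}$ and $A-A=\{a-b:a,b\in A\}$ (in both cases $a=b$ is allowed), and $|X|$ denotes the cardinality of a finite set $X$. *)

theory Defs
  imports Complex_Main
begin

end

theory Submission
  imports Defs
begin

text \<open>Let \<open>R d\<close> be the number of representations of \<open>d\<close> as a difference, \<open>P\<close> the set of positive
  differences and \<open>D\<close> its cardinality, and suppose that there are at least \<open>2 D + 2\<close> sums. A set
  consisting of six elements symmetric about a point and one more element has no more sums than
  differences, so every sum is represented by at most two unordered pairs of distinct elements.
  Counting the additive energy through sums and through differences then bounds the sum of \<open>(R d)\<^sup>2\<close>
  over \<open>P\<close> by \<open>125 - 8 D\<close>, while \<open>R\<close> sums to 21 over \<open>P\<close>. As \<open>(R - 2) (R - 3)\<close> and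
  \<open>(R - 3) (R - 4)\<close> are never negative, and \<open>R\<close> is 1 at the largest difference and at most 2 at the
  second largest, \<open>D\<close> is 8 or 9 and only the largest difference has \<open>R = 1\<close>. This forces the three
  elements at one end of the set into arithmetic progression; the sum of its outer terms has exactly
  three ordered representations, for which the energy bound has slack that is not available.\<close>

section \<open>Sums, differences and their representations\<close>

definition sumset :: "real set \<Rightarrow> real set" where
  "sumset A = {a + b |a b. a \<in> A \<and> b \<in> A}"

definition diffset :: "real set \<Rightarrow> real set" where
  "diffset A = {a - b |a b. a \<in> A \<and> b \<in> A}"

text \<open>A representation is recorded by its first summand, so pairs are ordered:
  \<open>a\<close> and \<open>s - a\<close> count separately.\<close>

definition sum_reps :: "real set \<Rightarrow> real \<Rightarrow> real set" where
  "sum_reps A s = {a \<in> A. s - a \<in> A}"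

definition diff_reps :: "real set \<Rightarrow> real \<Rightarrow> real set" where
  "diff_reps A d = {a \<in> A. a + d \<in> A}"

lemma sumset_eq_image: "sumset A = (\<lambda>(a, b). a + b) ` (A \<times> A)"
  by (auto simp: sumset_def)

lemma diffset_eq_image: "diffset A = (\<lambda>(a, b). b - a) ` (A \<times> A)"
  by (auto simp: diffset_def)

lemma finite_sumset [simp]: "finite A \<Longrightarrow> finite (sumset A)"
  by (simp add: sumset_eq_image)

lemma finite_diffset [simp]: "finite A \<Longrightarrow> finite (diffset A)"
  by (simp add: diffset_eq_image)

lemma finite_sum_reps [simp]: "finite A \<Longrightarrow> finite (sum_reps A s)"
  by (simp add: sum_reps_def)

lemma finite_diff_reps [simp]: "finite A \<Longrightarrow> finite (diff_reps A d)"
  by (simp add: diff_reps_def)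

lemma sumset_image: "sumset (f ` A) = (\<lambda>(a, b). f a + f b) ` (A \<times> A)"
  by (force simp: sumset_eq_image image_iff)

lemma diffset_image: "diffset (f ` A) = (\<lambda>(a, b). f b - f a) ` (A \<times> A)"
  by (force simp: diffset_eq_image image_iff)

lemma card_sumset_uminus: "card (sumset (uminus ` A)) = card (sumset A)"
proof -
  have "sumset (uminus ` A) = uminus ` sumset A"
    unfolding sumset_image unfolding sumset_eq_image
    by (simp add: image_image case_prod_unfold)
  then show ?thesis by (simp add: card_image)
qed

lemma card_diffset_uminus: "card (diffset (uminus ` A)) = card (diffset A)"
proof -
  have "diffset (uminus ` A) = uminus ` diffset A"
    unfolding diffset_image unfolding diffset_eq_image
    by (simp add: image_image case_prod_unfold)
  then show ?thesis by (simp add: card_image)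
qed

lemma card_sumset_translate: "card (sumset ((\<lambda>a. a - c) ` A)) = card (sumset A)"
proof -
  have "sumset ((\<lambda>a. a - c) ` A) = (\<lambda>v. v - 2 * c) ` sumset A"
    unfolding sumset_image unfolding sumset_eq_image
    by (simp add: image_image case_prod_unfold algebra_simps)
  then show ?thesis by (simp add: card_image inj_on_def)
qed

lemma diffset_translate: "diffset ((\<lambda>a. a - c) ` A) = diffset A"
  unfolding diffset_image unfolding diffset_eq_image by simp


section \<open>Sets with six symmetric elements\<close>

text \<open>The one case of \<open>card_sumset_le_diffset_symmetric_nonneg\<close> that has to be
  refuted. The lists hold the sums and differences of \<open>x\<close>, \<open>y\<close>,
  \<open>z\<close> that remain possible there; choosing one alternative from each leaves finitely
  many linear systems, all infeasible.\<close>

lemma symmetric_linear_system: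
  fixes w x y z :: real
  assumes "0 < x" "x < y" "y < z" "0 < w" "w < z" "w \<noteq> x" "w \<noteq> y"
    and "w + z \<in> {2*x, x+y, 2*y}"
    and "w + y \<in> {2*x, x+z, z-x, z-y} \<or> y + 2*w = z"
    and "w + x \<in> {2*y, y+z, y-x, z-x, z-y, 2*z} \<or> x + 2*w \<in> {y, z}"
    and "2*w \<notin> {2*x, 2*y, 2*z, x+y, x+z, y+z, y-x, z-x, z-y}"
  shows False
  using assms by (smt (verit) insert_iff empty_iff)

text \<open>Since \<open>B = -B\<close>, the sums and the differences of \<open>insert w B\<close> both contain
  \<open>U = (B + B) \<union> (w + B)\<close>; the sums add at most \<open>2 w\<close> to it, and the differences add \<open>-(w + B)\<close>.\<close>
lemma card_sumset_le_diffset_symmetric_nonneg: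
  assumes "0 < x" "x < y" "y < z" "0 \<le> w" "w \<notin> B" and B: "B = {x, y, z, -x, -y, -z}"
  shows "card (sumset (insert w B)) \<le> card (diffset (insert w B))"
proof -
  define U where "U = sumset B \<union> (+) w ` B"
  have Bneg: "- b \<in> B \<longleftrightarrow> b \<in> B" for b
    unfolding B by auto
  have [simp]: "finite B" unfolding B by simp
  then have [simp]: "finite U" by (simp add: U_def)
  have fin: "finite (diffset (insert w B))" by simp
  have S: "sumset (insert w B) = insert (w + w) U"
    unfolding sumset_def U_def by (auto simp: add.commute) (metis mult_2)
  have BB: "a - b \<in> sumset B" if "a \<in> B" "b \<in> B" for a b
    using that Bneg[of b] unfolding sumset_def
    by (metis (mono_tags, lifting) diff_conv_add_uminus mem_Collect_eq)
  have BB': "v \<in> diffset B" if v: "v \<in> sumset B" for v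
  proof -
    obtain a b where "v = a + b" "a \<in> B" "b \<in> B" using v by (auto simp: sumset_def)
    then have "v = a - (-b)" "a \<in> B" "-b \<in> B" using Bneg by auto
    then show ?thesis unfolding diffset_def by blast
  qed
  have U1: "U \<subseteq> diffset (insert w B)"
  proof
    fix v assume "v \<in> U"
    then consider "v \<in> sumset B" | b where "b \<in> B" "v = w + b" by (auto simp: U_def)
    then show "v \<in> diffset (insert w B)"
    proof cases
      case 1 then show ?thesis using BB'[of v] unfolding diffset_def by blast
    next
      case 2
      then have "v = w - (-b)" "-b \<in> B" using Bneg by auto
      then show ?thesis unfolding diffset_def by blast
    qed
  qed
  have U2: "- (w + b) \<in> diffset (insert w B)" if "b \<in> B" for b
  proof -
    have "- (w + b) = - b - w" "-b \<in> B" using Bneg that by auto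
    then show ?thesis unfolding diffset_def by blast
  qed
  \<comment> \<open>Some \<open>- (w + b)\<close> outside \<open>U\<close> is an extra difference
    that pays for the sum \<open>w + w\<close>. Otherwise \<open>w + w\<close> must already lie in
    \<open>U\<close>.\<close>
  show ?thesis
  proof (cases "\<exists>b\<in>B. - (w + b) \<notin> U")
    case True
    then obtain b where b: "b \<in> B" "- (w + b) \<notin> U" by blast
    have "card (insert (- (w + b)) U) \<le> card (diffset (insert w B))"
      using U1 U2[OF b(1)] by (intro card_mono fin) auto
    then show ?thesis using b(2) unfolding S by (simp add: card_insert_if)
  next
    case neg: False
    show ?thesis
    proof (cases "w + w \<in> U")
      case True
      then show ?thesis unfolding S using card_mono[OF fin U1] by (simp add: insert_absorb)
    next
      case False
      \<comment> \<open>By symmetry of \<open>B\<close>, \<open>- (w + b)\<close> lies in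
        \<open>B + B\<close> only if \<open>w + b\<close> does, and in \<open>w + B\<close> only if
        \<open>b + 2 * w\<close> is in \<open>B\<close>.\<close>
      have dis: "w + b \<in> sumset B \<or> b + 2 * w \<in> B" if b: "b \<in> B" for b
      proof -
        have "- (w + b) \<in> U" using neg b by blast
        then consider "- (w + b) \<in> sumset B" | c where "c \<in> B" "- (w + b) = w + c"
          by (auto simp: U_def)
        then show ?thesis
        proof cases
          case 1
          then obtain p q where pq: "- (w + b) = p + q" "p \<in> B" "q \<in> B"
            by (auto simp: sumset_def)
          then have "w + b = -p + -q" "-p \<in> B" "-q \<in> B" using Bneg by auto
          then show ?thesis unfolding sumset_def by blast
        next
          case 2
          then have "b + 2 * w = - c" by simp
          then show ?thesis using Bneg[of c] 2(1) by metis
        qed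
      qed
      have w0: "0 < w"
      proof -
        have "x - x \<in> sumset B" by (rule BB) (simp_all add: B)
        then show ?thesis using False \<open>0 \<le> w\<close> by (cases "w = 0") (auto simp: U_def)
      qed
      have sB: "v \<in> sumset B \<longleftrightarrow> (\<exists>p\<in>B. \<exists>q\<in>B. v = p + q)" for v
        by (auto simp: sumset_def)
      have xB: "x \<in> B" and yB: "y \<in> B" and zB: "z \<in> B" by (simp_all add: B)
      have wne: "w \<noteq> x" "w \<noteq> y" "w \<noteq> z" using \<open>w \<notin> B\<close> by (auto simp: B)
      \<comment> \<open>\<open>z + 2 * w\<close> exceeds all of \<open>B\<close>, and a summand
        \<open>z\<close> would put \<open>w\<close> into \<open>B\<close>. Hence
        \<open>w + z\<close> is at most \<open>2 * y\<close>, which gives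
        \<open>w < z\<close>.\<close>
      have 1: "w < z \<and> w + z \<in> {2*x, x+y, 2*y}"
        using dis[OF zB, unfolded sB, unfolded B] assms(1-3) w0 wne by auto
      have 2: "w + y \<in> {2*x, x+z, z-x, z-y} \<or> y + 2*w = z"
        using dis[OF yB, unfolded sB, unfolded B] assms(1-3) w0 wne 1 by auto
      have 3: "w + x \<in> {2*y, y+z, y-x, z-x, z-y, 2*z} \<or> x + 2*w \<in> {y, z}"
        using dis[OF xB, unfolded sB, unfolded B] assms(1-3) w0 wne 1 by auto
      have 4: "2*w \<notin> {2*x, 2*y, 2*z, x+y, x+z, y+z, y-x, z-x, z-y}"
        using False unfolding U_def Un_iff sB unfolding B by auto
      show ?thesis
        using symmetric_linear_system[of x y z w] 1 2 3 4 assms w0 wne by blast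
    qed
  qed
qed

text \<open>Negation fixes the symmetric part and preserves both cardinalities, so the seventh
  element may be taken nonnegative.\<close>

lemma card_sumset_le_diffset_symmetric:
  assumes A: "card A = 7" and xyz: "0 < x" "x < y" "y < z" "{x, y, z, -x, -y, -z} \<subseteq> A"
  shows "card (sumset A) \<le> card (diffset A)"
proof -
  define B where "B = {x, y, z, -x, -y, -z}"
  have "finite A" using A by (metis card.infinite zero_neq_numeral)
  have "card B = 6" using xyz(1-3) by (simp add: B_def card_insert_if)
  have "card (A - B) = 1"
    using card_Diff_subset[of B A] xyz(4) A \<open>card B = 6\<close> by (simp add: B_def)
  then obtain w where w: "A - B = {w}" by (auto simp: card_1_singleton_iff)
  have AB: "A = insert w B" "w \<notin> B" using w xyz(4) unfolding B_def by auto
  show ?thesis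
  proof (cases "0 \<le> w")
    case True
    then show ?thesis
      using card_sumset_le_diffset_symmetric_nonneg[OF xyz(1-3) True AB(2) B_def] AB(1) by simp
  next
    case False
    have neg: "uminus ` A = insert (-w) B" unfolding AB(1) B_def by auto
    have "-w \<notin> B" using AB(2) unfolding B_def by auto
    then show ?thesis
      using card_sumset_le_diffset_symmetric_nonneg[OF xyz(1-3) _ _ B_def, of "-w"] False neg
      by (metis card_diffset_uminus card_sumset_uminus neg_0_le_iff_le linear)
  qed
qed

lemma card_3_sorted:
  fixes T :: "'a::linorder set"
  assumes "card T = 3"
  obtains x y z where "T = {x, y, z}" "x < y" "y < z"
proof -
  obtain a b c where "T = {a, b, c}" "a \<noteq> b" "b \<noteq> c" "a \<noteq> c"
    using assms by (auto simp: card_3_iff)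
  moreover from this have "\<exists>x y z. {a, b, c} = {x, y, z} \<and> x < y \<and> y < z"
    by (metis insert_commute linorder_neqE)
  ultimately show thesis using that by metis
qed

text \<open>The condition \<open>2 * a < s\<close> selects the smaller member of each unordered
  pair. Three pairs with the common sum \<open>s\<close> become six points symmetric about 0 after
  translation by \<open>s/2\<close>.\<close>

lemma card_sumset_le_diffset_three_reps:
  assumes A: "card A = 7" and T: "3 \<le> card {a \<in> A. s - a \<in> A \<and> 2 * a < s}"
  shows "card (sumset A) \<le> card (diffset A)"
proof -
  obtain T' where T': "T' \<subseteq> {a \<in> A. s - a \<in> A \<and> 2 * a < s}" "card T' = 3"
    using T by (meson obtain_subset_with_card_n)
  obtain a b c where abc: "T' = {a, b, c}" "a < b" "b < c" using card_3_sorted[OF T'(2)] .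
  let ?A = "(\<lambda>a. a - s/2) ` A"
  have m: "{a, b, c, s - a, s - b, s - c} \<subseteq> A" "2 * c < s" using T'(1) abc by auto
  have "{s/2 - c, s/2 - b, s/2 - a, -(s/2 - c), -(s/2 - b), -(s/2 - a)}
        = (\<lambda>a. a - s/2) ` {a, b, c, s - a, s - b, s - c}"
    by (auto simp: image_iff field_simps)
  also have "\<dots> \<subseteq> ?A" using m(1) by (intro image_mono)
  finally have sub: "{s/2 - c, s/2 - b, s/2 - a, -(s/2 - c), -(s/2 - b), -(s/2 - a)} \<subseteq> ?A" .
  have "card ?A = 7" using A by (simp add: card_image inj_on_def)
  then have "card (sumset ?A) \<le> card (diffset ?A)"
    using card_sumset_le_diffset_symmetric[OF _ _ _ _ sub] m(2) abc(2,3) by simp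
  then show ?thesis by (simp add: card_sumset_translate diffset_translate)
qed


section \<open>Representation counts and additive energy\<close>

lemma sum_card_fibres:
  assumes "finite X"
  shows "(\<Sum>v\<in>g ` X. card {p \<in> X. g p = v}) = card X"
  using sum.image_gen[OF assms, of "\<lambda>_. 1::nat" g] by simp

lemma sum_card_fibres_sq:
  assumes "finite X"
  shows "(\<Sum>v\<in>g ` X. (card {p \<in> X. g p = v})\<^sup>2) = card {(p, q). p \<in> X \<and> q \<in> X \<and> g p = g q}"
proof -
  have "{(p, q). p \<in> X \<and> q \<in> X \<and> g p = g q}
      = (\<Union>v\<in>g ` X. {p \<in> X. g p = v} \<times> {p \<in> X. g p = v})" by auto
  moreover have "card \<dots> = (\<Sum>v\<in>g ` X. card ({p \<in> X. g p = v} \<times> {p \<in> X. g p = v}))"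
    using assms by (intro card_UN_disjoint) auto
  ultimately show ?thesis by (simp add: card_cartesian_product power2_eq_square)
qed

lemma card_fibre_sum: "card {p \<in> A \<times> A. (case p of (a, b) \<Rightarrow> a + b) = s} = card (sum_reps A s)"
proof -
  have "{p \<in> A \<times> A. (case p of (a, b) \<Rightarrow> a + b) = s} = (\<lambda>a. (a, s - a)) ` sum_reps A s"
    by (auto simp: sum_reps_def image_iff)
  then show ?thesis by (simp add: card_image inj_on_def)
qed

lemma card_fibre_diff: "card {p \<in> A \<times> A. (case p of (a, b) \<Rightarrow> b - a) = d} = card (diff_reps A d)"
proof -
  have "{p \<in> A \<times> A. (case p of (a, b) \<Rightarrow> b - a) = d} = (\<lambda>a. (a, a + d)) ` diff_reps A d"
    by (auto simp: diff_reps_def image_iff)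
  then show ?thesis by (simp add: card_image inj_on_def)
qed

lemma sum_card_sum_reps:
  assumes "finite A"
  shows "(\<Sum>s\<in>sumset A. card (sum_reps A s)) = (card A)\<^sup>2"
  using sum_card_fibres[of "A \<times> A" "\<lambda>(a, b). a + b"] assms
  by (simp add: card_fibre_sum sumset_eq_image card_cartesian_product power2_eq_square)

lemma sum_card_diff_reps:
  assumes "finite A"
  shows "(\<Sum>d\<in>diffset A. card (diff_reps A d)) = (card A)\<^sup>2"
  using sum_card_fibres[of "A \<times> A" "\<lambda>(a, b). b - a"] assms
  by (simp add: card_fibre_diff diffset_eq_image card_cartesian_product power2_eq_square)

text \<open>Both sides are the additive energy: \<open>a + b = c + d\<close> if and only if \<open>c - a = b - d\<close>.\<close>
lemma sum_sq_sum_reps_eq_diff_reps: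
  assumes "finite A"
  shows "(\<Sum>s\<in>sumset A. (card (sum_reps A s))\<^sup>2) = (\<Sum>d\<in>diffset A. (card (diff_reps A d))\<^sup>2)"
proof -
  let ?E = "{(p, q). p \<in> A \<times> A \<and> q \<in> A \<times> A \<and>
    (case p of (a, b) \<Rightarrow> a + b) = (case q of (a, b) \<Rightarrow> a + b)}"
  let ?F = "{(p, q). p \<in> A \<times> A \<and> q \<in> A \<times> A \<and>
    (case p of (a, b) \<Rightarrow> b - a) = (case q of (a, b) \<Rightarrow> b - a)}"
  have "bij_betw (\<lambda>((a, b), (c, d)). ((a, c), (d, b))) ?E ?F"
    by (rule bij_betw_byWitness[where f' = "\<lambda>((a, c), (d, b)). ((a, b), (c, d))"]) auto
  then have "card ?E = card ?F" by (rule bij_betw_same_card)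
  then show ?thesis
    using sum_card_fibres_sq[of "A \<times> A" "\<lambda>(a, b). a + b"]
      sum_card_fibres_sq[of "A \<times> A" "\<lambda>(a, b). b - a"] assms
    by (simp add: card_fibre_sum card_fibre_diff sumset_eq_image diffset_eq_image)
qed

section \<open>Reduction to positive differences\<close>

definition pos_diffs :: "real set \<Rightarrow> real set" where
  "pos_diffs A = {d \<in> diffset A. 0 < d}"

lemma pos_diffsI: "a \<in> A \<Longrightarrow> b \<in> A \<Longrightarrow> a < b \<Longrightarrow> b - a \<in> pos_diffs A"
  by (auto simp: pos_diffs_def diffset_def)

lemma diffset_decomp:
  assumes "A \<noteq> {}"
  shows "diffset A = insert 0 (pos_diffs A \<union> uminus ` pos_diffs A)"
proof -
  have "- d \<in> diffset A" if "d \<in> diffset A" for d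
    using that unfolding diffset_def by (auto, metis minus_diff_eq)
  moreover have "0 \<in> diffset A" using assms by (auto simp: diffset_def)
  ultimately show ?thesis
    unfolding pos_diffs_def
    by (auto simp: image_iff) (metis add.inverse_inverse linorder_neqE_linordered_idom neg_0_less_iff_less)
qed

lemma card_diff_reps_uminus: "card (diff_reps A (- d)) = card (diff_reps A d)"
proof -
  have "diff_reps A (- d) = (\<lambda>a. a + d) ` diff_reps A d"
    by (force simp: diff_reps_def image_iff)
  then show ?thesis by (simp add: card_image)
qed

text \<open>Opposite differences have equally many representations, and 0 has \<open>card A\<close>.
  The function \<open>f\<close> is left general to cover cardinality, first and second moments at
  once.\<close>

lemma sum_diffset_decomp:
  fixes f :: "nat \<Rightarrow> nat"
  assumes "finite A" "A \<noteq> {}"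
  shows "(\<Sum>d\<in>diffset A. f (card (diff_reps A d)))
    = f (card A) + 2 * (\<Sum>d\<in>pos_diffs A. f (card (diff_reps A d)))"
proof -
  let ?P = "pos_diffs A"
  let ?g = "\<lambda>d. f (card (diff_reps A d))"
  have fin: "finite ?P" using assms(1) by (simp add: pos_diffs_def)
  have pos: "0 < d" if "d \<in> ?P" for d using that by (simp add: pos_diffs_def)
  have neg: "sum ?g (uminus ` ?P) = sum ?g ?P"
    by (subst sum.reindex) (auto simp: card_diff_reps_uminus)
  have "0 \<notin> ?P \<union> uminus ` ?P" using pos by force
  then have "sum ?g (diffset A) = ?g 0 + sum ?g (?P \<union> uminus ` ?P)"
    using fin by (simp add: diffset_decomp[OF assms(2)])
  also have "sum ?g (?P \<union> uminus ` ?P) = sum ?g ?P + sum ?g (uminus ` ?P)"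
    using fin by (intro sum.union_disjoint) (auto dest!: pos)
  also have "?g 0 = f (card A)" by (simp add: diff_reps_def)
  finally show ?thesis by (simp add: neg)
qed

lemma card_diffset:
  assumes "finite A" "A \<noteq> {}"
  shows "card (diffset A) = Suc (2 * card (pos_diffs A))"
  using sum_diffset_decomp[OF assms, of "\<lambda>_. 1"] by simp


text \<open>The involution taking \<open>a\<close> to \<open>s - a\<close> exchanges the
  representations below and above \<open>s/2\<close> and fixes only the midpoint.\<close>

lemma card_sum_reps_split:
  assumes "finite A"
  shows "card (sum_reps A s)
    = 2 * card {a \<in> A. s - a \<in> A \<and> 2 * a < s} + card {a \<in> A. 2 * a = s}"
proof -
  let ?L = "{a \<in> A. s - a \<in> A \<and> 2 * a < s}"
  let ?R = "{a \<in> A. s - a \<in> A \<and> s < 2 * a}"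
  let ?M = "{a \<in> A. 2 * a = s}"
  have "a \<in> (\<lambda>a. s - a) ` ?L" if "a \<in> ?R" for a
    using that by (intro image_eqI[of _ _ "s - a"]) auto
  then have "?R \<subseteq> (\<lambda>a. s - a) ` ?L" by (rule subsetI)
  moreover have "(\<lambda>a. s - a) ` ?L \<subseteq> ?R" by auto
  ultimately have "?R = (\<lambda>a. s - a) ` ?L" by (rule subset_antisym)
  then have R: "card ?R = card ?L" by (simp add: card_image inj_on_def)
  have "sum_reps A s = (?L \<union> ?R) \<union> ?M" by (auto simp: sum_reps_def)
  moreover have "(?L \<union> ?R) \<inter> ?M = {}" "?L \<inter> ?R = {}" by auto
  moreover have "finite ?L" "finite ?R" "finite ?M" using assms by simp_all
  ultimately have "card (sum_reps A s) = card ?L + card ?R + card ?M"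
    by (simp only: card_Un_disjoint finite_Un simp_thms)
  then show ?thesis using R by linarith
qed

lemma sum_card_halves:
  assumes "finite A"
  shows "(\<Sum>s\<in>sumset A. card {a \<in> A. 2 * a = s}) = card A"
proof -
  have "(\<lambda>a. 2 * a) ` A \<subseteq> sumset A"
    unfolding sumset_def by (auto, metis mult_2)
  then have "(\<Sum>s\<in>sumset A. card {a \<in> A. 2 * a = s})
    = (\<Sum>s\<in>(\<lambda>a. 2 * a) ` A. card {a \<in> A. 2 * a = s})"
    using assms by (intro sum.mono_neutral_right) auto
  then show ?thesis using sum_card_fibres[OF assms, of "\<lambda>a. 2 * a"] by simp
qed

text \<open>Summing \<open>m\<^sup>2 \<le> 6 m + 3 p - 8\<close>, valid for \<open>m = 2 l + p > 0\<close> with \<open>l \<le> 2\<close> and \<open>p \<le> 1\<close>;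
  the case \<open>m = 3\<close> has slack 4.\<close>
lemma sum_sq_sum_reps_le:
  assumes "finite A"
    and two: "\<And>s. card {a \<in> A. s - a \<in> A \<and> 2 * a < s} \<le> 2"
  shows "(\<Sum>s\<in>sumset A. (card (sum_reps A s))\<^sup>2) + 8 * card (sumset A)
      + 4 * card {s \<in> sumset A. card (sum_reps A s) = 3}
    \<le> 6 * (card A)\<^sup>2 + 3 * card A"
proof -
  let ?m = "\<lambda>s. card (sum_reps A s)"
  let ?p = "\<lambda>s. card {a \<in> A. 2 * a = s}"
  have pt: "(?m s)\<^sup>2 + 8 + (if ?m s = 3 then 4 else 0) \<le> 6 * ?m s + 3 * ?p s"
    if s: "s \<in> sumset A" for s
  proof -
    have "{a \<in> A. 2 * a = s} \<subseteq> {s/2}" by auto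
    then have p: "?p s \<le> 1" using card_mono[of "{s/2}"] by simp
    have "sum_reps A s \<noteq> {}" using s by (force simp: sumset_def sum_reps_def)
    then have m0: "?m s \<noteq> 0" using assms(1) by simp
    obtain l where l: "?m s = 2 * l + ?p s" "l \<le> 2"
      using card_sum_reps_split[OF assms(1)] two by blast
    \<comment> \<open>Apart from \<open>m = 0\<close>, excluded by \<open>m0\<close>, the five
      combinations all give equality in \<open>pt\<close>.\<close>
    have "l = 0 \<or> l = 1 \<or> l = 2" "?p s = 0 \<or> ?p s = 1" using l p by auto
    then show ?thesis using l m0 by (elim disjE) (simp_all add: power2_eq_square)
  qed
  have c3: "(\<Sum>s\<in>sumset A. if ?m s = 3 then 4 else 0) = 4 * card {s \<in> sumset A. ?m s = 3}"
    using assms(1) by (simp add: sum.If_cases Int_def)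
  have "(\<Sum>s\<in>sumset A. (?m s)\<^sup>2 + 8 + (if ?m s = 3 then 4 else 0))
    \<le> (\<Sum>s\<in>sumset A. 6 * ?m s + 3 * ?p s)" by (intro sum_mono pt)
  then show ?thesis
    using assms(1) sum_card_sum_reps[OF assms(1)] sum_card_halves[OF assms(1)]
    by (simp add: sum.distrib c3 flip: sum_distrib_left)
qed


section \<open>The largest differences\<close>

lemma ex_other_element:
  assumes "2 \<le> card X"
  shows "\<exists>b\<in>X. b \<noteq> a"
proof (rule ccontr)
  assume "\<not> ?thesis"
  then have "X \<subseteq> {a}" by blast
  then have "card X \<le> 1" using card_mono[of "{a}" X] by simp
  then show False using assms by simp
qed

lemma card_le_2I:
  assumes "X \<subseteq> {a, b}"
  shows "card X \<le> 2"
proof -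
  have "card X \<le> card {a, b}" using assms by (intro card_mono) auto
  also have "\<dots> \<le> 2" by (simp add: card_insert_if)
  finally show ?thesis .
qed

context
  fixes A :: "real set" and x1 x2 x3 x4 x5 x6 x7 :: real
  assumes A: "A = {x1, x2, x3, x4, x5, x6, x7}"
    and ord: "x1 < x2" "x2 < x3" "x3 < x4" "x4 < x5" "x5 < x6" "x6 < x7"
begin

lemma mem_A: "a \<in> A \<longleftrightarrow> a = x1 \<or> a = x2 \<or> a = x3 \<or> a = x4 \<or> a = x5 \<or> a = x6 \<or> a = x7"
  by (simp add: A)

lemma card_diff_reps_largest: "card (diff_reps A (x7 - x1)) = 1"
proof -
  have "diff_reps A (x7 - x1) = {x1}"
    unfolding diff_reps_def A using ord by auto
  then show ?thesis by simp
qed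

lemma ex_second_largest:
  "\<exists>u\<in>pos_diffs A. u \<noteq> x7 - x1 \<and> card (diff_reps A u) \<le> 2"
proof -
  \<comment> \<open>Every difference other than \<open>x7 - x1\<close> omits an end of the set, so
    this is the second largest. Only the pairs \<open>x1\<close>, \<open>x6\<close> and
    \<open>x2\<close>, \<open>x7\<close> can attain it.\<close>
  define u where "u = max (x7 - x2) (x6 - x1)"
  have "u = x7 - x2 \<or> u = x6 - x1" "x7 - x2 \<le> u" "x6 - x1 \<le> u" unfolding u_def by auto
  note u = this
  have "a = x1 \<or> a = x2" if "a \<in> A" "a + u \<in> A" for a
    using that ord u(2,3) unfolding mem_A
    by (elim disjE) (linarith | simp)+
  then have "diff_reps A u \<subseteq> {x1, x2}" by (auto simp: diff_reps_def)
  moreover have "x7 - x2 \<in> pos_diffs A" "x6 - x1 \<in> pos_diffs A"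
    using ord by (simp_all add: pos_diffsI A)
  ultimately show ?thesis using u(1) ord by (intro bexI[of _ u] conjI card_le_2I) auto
qed

text \<open>If only \<open>x7 - x1\<close> is represented once, then comparing the next two, and then the next three,
  largest differences shows that both gaps at one end equal the extreme gap at the other end.\<close>
lemma end_progression:
  assumes rep: "\<And>d. d \<in> pos_diffs A \<Longrightarrow> d \<noteq> x7 - x1 \<Longrightarrow> 2 \<le> card (diff_reps A d)"
    and two: "\<And>s. card {a \<in> A. s - a \<in> A \<and> 2 * a < s} \<le> 2"
  shows "x7 - x2 = x6 - x1"
    and "x7 - x3 = x6 - x2 \<and> x5 - x1 < x6 - x2 \<or> x5 - x1 = x6 - x2 \<and> x7 - x3 < x6 - x2"
proof -
  have other: "\<exists>a'\<in>A. a' \<noteq> a \<and> a' + (b - a) \<in> A"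
    if "a \<in> A" "b \<in> A" "a < b" "b - a \<noteq> x7 - x1" for a b
    using ex_other_element[OF rep[OF pos_diffsI[OF that(1-3)] that(4)], of a]
    by (auto simp: diff_reps_def)
  \<comment> \<open>A second representation of \<open>x7 - x2\<close> must start at
    \<open>x1\<close> and end at \<open>x6\<close> or lower.\<close>
  have "x7 - x2 \<le> x6 - x1"
    using other[of x2 x7] ord unfolding A by auto
  moreover have "x6 - x1 \<le> x7 - x2"
    using other[of x1 x6] ord unfolding A by auto
  ultimately show e: "x7 - x2 = x6 - x1" by simp
  \<comment> \<open>Each of \<open>x7 - x3\<close>, \<open>x6 - x2\<close>, \<open>x5 - x1\<close>
    is at most one of the other two, so their maximum is attained twice.\<close>
  have v1: "x7 - x3 \<le> x6 - x2 \<or> x7 - x3 \<le> x5 - x1"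
    using other[of x3 x7] e ord unfolding A by auto
  have v2: "x6 - x2 \<le> x7 - x3 \<or> x6 - x2 \<le> x5 - x1"
    using other[of x2 x6] e ord unfolding A by auto
  have v3: "x5 - x1 \<le> x7 - x3 \<or> x5 - x1 \<le> x6 - x2"
    using other[of x1 x5] e ord unfolding A by auto
  \<comment> \<open>Equality would give \<open>x1 + x7 = x2 + x6 = x3 + x5\<close>, three pairs with
    one sum.\<close>
  have ne: "x7 - x3 \<noteq> x5 - x1"
  proof
    assume "x7 - x3 = x5 - x1"
    then have q: "x1 + x7 - x1 = x7" "x1 + x7 - x2 = x6" "x1 + x7 - x3 = x5" using e by auto
    have "x1 + x7 - x1 \<in> A" "x1 + x7 - x2 \<in> A" "x1 + x7 - x3 \<in> A"
      unfolding q by (simp_all add: A)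
    moreover have "2 * x1 < x1 + x7" "2 * x2 < x1 + x7" "2 * x3 < x1 + x7"
      using q ord by linarith+
    moreover have "x1 \<in> A" "x2 \<in> A" "x3 \<in> A" by (simp_all add: A)
    ultimately have "{x1, x2, x3} \<subseteq> {a \<in> A. x1 + x7 - a \<in> A \<and> 2 * a < x1 + x7}"
      by blast
    then have "card {x1, x2, x3} \<le> card {a \<in> A. x1 + x7 - a \<in> A \<and> 2 * a < x1 + x7}"
      by (rule card_mono[rotated]) (simp add: A)
    then show False using two[of "x1 + x7"] ord by simp
  qed
  show "x7 - x3 = x6 - x2 \<and> x5 - x1 < x6 - x2 \<or> x5 - x1 = x6 - x2 \<and> x7 - x3 < x6 - x2"
    using v1 v2 v3 ne by linarith
qed

text \<open>The witnesses are the second and third largest differences: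
  \<open>x7 - x2 = x6 - x1\<close>, and \<open>x6 - x2\<close>, which coincides with exactly one of
  \<open>x7 - x3\<close> and \<open>x5 - x1\<close>.\<close>

lemma two_further_differences:
  assumes rep: "\<And>d. d \<in> pos_diffs A \<Longrightarrow> d \<noteq> x7 - x1 \<Longrightarrow> 2 \<le> card (diff_reps A d)"
    and two: "\<And>s. card {a \<in> A. s - a \<in> A \<and> 2 * a < s} \<le> 2"
  shows "\<exists>u\<in>pos_diffs A. \<exists>v\<in>pos_diffs A. u \<noteq> x7 - x1 \<and> v \<noteq> x7 - x1 \<and> u \<noteq> v \<and>
    card (diff_reps A u) \<le> 2 \<and> card (diff_reps A v) \<le> 2"
proof -
  note e = end_progression[OF rep two]
  have "a = x1 \<or> a = x2" if "a \<in> A" "a + (x7 - x2) \<in> A" for a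
    using that ord e(1) unfolding mem_A
    by (elim disjE) (linarith | simp)+
  then have "diff_reps A (x7 - x2) \<subseteq> {x1, x2}" by (auto simp: diff_reps_def)
  then have 1: "card (diff_reps A (x7 - x2)) \<le> 2" by (rule card_le_2I)
  have 2: "card (diff_reps A (x6 - x2)) \<le> 2"
    using e(2)
  proof
    assume h: "x7 - x3 = x6 - x2 \<and> x5 - x1 < x6 - x2"
    have "a = x2 \<or> a = x3" if "a \<in> A" "a + (x6 - x2) \<in> A" for a
      using that ord e(1) conjunct1[OF h] conjunct2[OF h] unfolding mem_A
      by (elim disjE) (linarith | simp)+
    then have "diff_reps A (x6 - x2) \<subseteq> {x2, x3}" by (auto simp: diff_reps_def)
    then show ?thesis by (rule card_le_2I)
  next
    assume h: "x5 - x1 = x6 - x2 \<and> x7 - x3 < x6 - x2"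
    have "a = x1 \<or> a = x2" if "a \<in> A" "a + (x6 - x2) \<in> A" for a
      using that ord e(1) conjunct1[OF h] conjunct2[OF h] unfolding mem_A
      by (elim disjE) (linarith | simp)+
    then have "diff_reps A (x6 - x2) \<subseteq> {x1, x2}" by (auto simp: diff_reps_def)
    then show ?thesis by (rule card_le_2I)
  qed
  have "x7 - x2 \<in> pos_diffs A" "x6 - x2 \<in> pos_diffs A"
    using ord by (simp_all add: pos_diffsI A)
  moreover have "x7 - x2 \<noteq> x7 - x1" "x6 - x2 \<noteq> x7 - x1" "x7 - x2 \<noteq> x6 - x2"
    using ord by simp_all
  ultimately show ?thesis using 1 2 by blast
qed

text \<open>Three end elements form a progression; twice its middle term is also the sum of its
  outer terms, and any further element would need a partner beyond the end of
  \<open>A\<close>.\<close>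

lemma ex_sum_with_three_reps:
  assumes rep: "\<And>d. d \<in> pos_diffs A \<Longrightarrow> d \<noteq> x7 - x1 \<Longrightarrow> 2 \<le> card (diff_reps A d)"
    and two: "\<And>s. card {a \<in> A. s - a \<in> A \<and> 2 * a < s} \<le> 2"
  shows "{s \<in> sumset A. card (sum_reps A s) = 3} \<noteq> {}"
proof -
  note e = end_progression[OF rep two]
  have "\<exists>a\<in>A. card (sum_reps A (2 * a)) = 3"
    using e(2)
  proof
    assume "x7 - x3 = x6 - x2 \<and> x5 - x1 < x6 - x2"
    then have q: "2 * x2 - x1 = x3" "2 * x2 - x3 = x1" "2 * x2 - x2 = x2" using e(1) by auto
    have "sum_reps A (2 * x2) = {x1, x2, x3}"
    proof
      have "2 * x2 - x1 \<in> A" "2 * x2 - x2 \<in> A" "2 * x2 - x3 \<in> A"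
        unfolding q by (simp_all add: A)
      moreover have "x1 \<in> A" "x2 \<in> A" "x3 \<in> A" by (simp_all add: A)
      ultimately show "{x1, x2, x3} \<subseteq> sum_reps A (2 * x2)"
        unfolding sum_reps_def by blast
      have "a = x1 \<or> a = x2 \<or> a = x3" if "a \<in> A" "2 * x2 - a \<in> A" for a
        using that ord q(1,2) unfolding mem_A
        by (elim disjE) (linarith | simp)+
      then show "sum_reps A (2 * x2) \<subseteq> {x1, x2, x3}" by (auto simp: sum_reps_def)
    qed
    then show ?thesis using ord by (intro bexI[of _ x2]) (auto simp: A)
  next
    assume "x5 - x1 = x6 - x2 \<and> x7 - x3 < x6 - x2"
    then have q: "2 * x6 - x5 = x7" "2 * x6 - x7 = x5" "2 * x6 - x6 = x6" using e(1) by auto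
    have "sum_reps A (2 * x6) = {x5, x6, x7}"
    proof
      have "2 * x6 - x5 \<in> A" "2 * x6 - x6 \<in> A" "2 * x6 - x7 \<in> A"
        unfolding q by (simp_all add: A)
      moreover have "x5 \<in> A" "x6 \<in> A" "x7 \<in> A" by (simp_all add: A)
      ultimately show "{x5, x6, x7} \<subseteq> sum_reps A (2 * x6)"
        unfolding sum_reps_def by blast
      have "a = x5 \<or> a = x6 \<or> a = x7" if "a \<in> A" "2 * x6 - a \<in> A" for a
        using that ord q(1,2) unfolding mem_A
        by (elim disjE) (linarith | simp)+
      then show "sum_reps A (2 * x6) \<subseteq> {x5, x6, x7}" by (auto simp: sum_reps_def)
    qed
    then show ?thesis using ord by (intro bexI[of _ x6]) (auto simp: A)
  qed
  moreover have "2 * a \<in> sumset A" if "a \<in> A" for a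
    using that unfolding sumset_def by (auto, metis mult_2)
  ultimately show ?thesis by blast
qed

end

lemma sorted_7:
  fixes A :: "'a::linorder set"
  assumes "card A = 7"
  obtains x1 x2 x3 x4 x5 x6 x7 where "A = {x1, x2, x3, x4, x5, x6, x7}"
    "x1 < x2" "x2 < x3" "x3 < x4" "x4 < x5" "x5 < x6" "x6 < x7"
proof -
  have "finite A" using assms by (metis card.infinite zero_neq_numeral)
  define xs where "xs = sorted_list_of_set A"
  have xs: "set xs = A" "sorted_wrt (<) xs" "length xs = 7"
    using \<open>finite A\<close> assms by (simp_all add: xs_def)
  then obtain x1 x2 x3 x4 x5 x6 x7 where "xs = [x1, x2, x3, x4, x5, x6, x7]"
    by (auto simp: numeral_eq_Suc length_Suc_conv)
  then show thesis using xs by (intro that[of x1 x2 x3 x4 x5 x6 x7]) auto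
qed


section \<open>Counting\<close>

lemma sum_quadratic:
  fixes r :: "'a \<Rightarrow> nat" and a b :: int
  shows "(\<Sum>d\<in>P. (int (r d) - a) * (int (r d) - b))
    = int (\<Sum>d\<in>P. (r d)\<^sup>2) - (a + b) * int (\<Sum>d\<in>P. r d) + a * b * int (card P)"
  by (simp add: algebra_simps power2_eq_square sum.distrib sum_subtractf sum_distrib_left)

lemma consecutive_prod_nonneg: "0 \<le> (k - a) * (k - (a + 1))" for k a :: int
  by (cases "k \<le> a") (auto intro: mult_nonpos_nonpos mult_nonneg_nonneg)

context
  fixes P :: "'a set" and r :: "'a \<Rightarrow> nat" and t u :: 'a
  assumes fin: "finite P" and r: "(\<Sum>d\<in>P. r d) = 21"
    and sq: "(\<Sum>d\<in>P. (r d)\<^sup>2) + 8 * card P \<le> 125"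
    and t: "t \<in> P" "r t = 1" and u: "u \<in> P" "u \<noteq> t" "r u \<le> 2"
begin

lemma sum_ge_subset:
  fixes a :: int
  assumes "X \<subseteq> P"
  shows "(\<Sum>d\<in>X. (int (r d) - a) * (int (r d) - (a + 1)))
    \<le> int (\<Sum>d\<in>P. (r d)\<^sup>2) - (2 * a + 1) * 21 + a * (a + 1) * int (card P)"
proof -
  have "(\<Sum>d\<in>X. (int (r d) - a) * (int (r d) - (a + 1)))
      \<le> (\<Sum>d\<in>P. (int (r d) - a) * (int (r d) - (a + 1)))"
    by (intro sum_mono2 fin assms consecutive_prod_nonneg)
  then show ?thesis unfolding sum_quadratic r by (simp add: algebra_simps)
qed

lemma small_r: "r d \<le> 2 \<Longrightarrow> 2 \<le> (int (r d) - 3) * (int (r d) - 4)"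
  by (cases "r d = 0 \<or> r d = 1 \<or> r d = 2") auto

lemma tiny_r: "r d \<le> 1 \<Longrightarrow> 6 \<le> (int (r d) - 3) * (int (r d) - 4)
    \<and> 2 \<le> (int (r d) - 2) * (int (r d) - 3)"
  by (cases "r d = 0 \<or> r d = 1") auto

text \<open>With \<open>sq\<close>, the term of \<open>t\<close> at \<open>a = 2\<close> gives
  \<open>2 * card P \<le> 18\<close>; the terms of \<open>t\<close> and \<open>u\<close> at
  \<open>a = 3\<close> give \<open>4 * card P \<ge> 30\<close>.\<close>

lemma card_8_or_9: "card P = 8 \<or> card P = 9"
proof -
  have "2 \<le> int (\<Sum>d\<in>P. (r d)\<^sup>2) - 105 + 6 * int (card P)"
    using sum_ge_subset[of "{t}" 2] t by simp
  moreover have "8 \<le> int (\<Sum>d\<in>P. (r d)\<^sup>2) - 147 + 12 * int (card P)"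
    using sum_ge_subset[of "{t, u}" 3] t u small_r[of u] by simp
  ultimately show ?thesis using sq by linarith
qed

text \<open>A second value at most 1 sharpens both bounds, to \<open>card P \<le> 8\<close> and
  \<open>card P \<ge> 9\<close>.\<close>

lemma only_one_single: assumes d: "d \<in> P" "d \<noteq> t" shows "2 \<le> r d"
proof (rule ccontr)
  assume "\<not> ?thesis"
  then have "r d \<le> 1" by simp
  note tiny = tiny_r[OF this]
  have "4 \<le> int (\<Sum>d\<in>P. (r d)\<^sup>2) - 105 + 6 * int (card P)"
    using sum_ge_subset[of "{t, d}" 2] t d tiny by simp
  moreover have "12 \<le> int (\<Sum>d\<in>P. (r d)\<^sup>2) - 147 + 12 * int (card P)"
    using sum_ge_subset[of "{t, d}" 3] t d tiny by simp
  ultimately show False using sq card_8_or_9 by linarith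
qed

text \<open>The two bounds read \<open>107 + 2 * card P\<close> and \<open>157 - 4 * card P\<close>;
  the first yields 125 when \<open>card P = 9\<close>, the second when \<open>card P = 8\<close>.
  The weaker 124 is enough for the final contradiction.\<close>

lemma sum_sq_tight:
  assumes v: "v \<in> P" "v \<noteq> t" "v \<noteq> u" "r v \<le> 2"
  shows "124 \<le> (\<Sum>d\<in>P. (r d)\<^sup>2) + 8 * card P"
proof -
  have "2 \<le> int (\<Sum>d\<in>P. (r d)\<^sup>2) - 105 + 6 * int (card P)"
    using sum_ge_subset[of "{t}" 2] t by simp
  moreover have "10 \<le> int (\<Sum>d\<in>P. (r d)\<^sup>2) - 147 + 12 * int (card P)"
    using sum_ge_subset[of "{t, u, v}" 3] t u v small_r[of u] small_r[of v] by simp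
  ultimately show ?thesis using card_8_or_9 by linarith
qed

end

theorem theorem1p1:
  fixes A :: "real set"
  assumes "card A = 7"
  shows "card {a + b |a b. a \<in> A \<and> b \<in> A} \<le> card {a - b |a b. a \<in> A \<and> b \<in> A}"
proof -
  have "card (sumset A) \<le> card (diffset A)"
  proof (rule ccontr)
    assume neg: "\<not> ?thesis"
    have two: "card {a \<in> A. s - a \<in> A \<and> 2 * a < s} \<le> 2" for s
      using card_sumset_le_diffset_three_reps[OF assms, of s] neg by linarith
    have fin: "finite A" "A \<noteq> {}" using assms by (auto intro: card_ge_0_finite)
    let ?P = "pos_diffs A"
    let ?r = "\<lambda>d. card (diff_reps A d)"
    let ?K = "{s \<in> sumset A. card (sum_reps A s) = 3}"
    obtain x1 x2 x3 x4 x5 x6 x7 where x: "A = {x1, x2, x3, x4, x5, x6, x7}"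
      "x1 < x2" "x2 < x3" "x3 < x4" "x4 < x5" "x5 < x6" "x6 < x7"
      using sorted_7[OF assms] .
    have finP: "finite ?P" using fin by (simp add: pos_diffs_def)
    \<comment> \<open>Here 21 is half of \<open>49 - 7\<close>.\<close>
    have sum_r: "(\<Sum>d\<in>?P. ?r d) = 21"
      using sum_diffset_decomp[OF fin, of "\<lambda>n. n"] sum_card_diff_reps[OF fin(1)] assms by simp
    \<comment> \<open>The energy is 49 plus twice the sum over \<open>?P\<close>, and there are at
      least \<open>2 * card ?P + 2\<close> sums. Halving \<open>6 * 49 + 21 - 16 - 49 = 250\<close>
      gives 125 and turns the slack 4 into 2.\<close>
    have sq: "(\<Sum>d\<in>?P. (?r d)\<^sup>2) + 8 * card ?P + 2 * card ?K \<le> 125"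
      using sum_sq_sum_reps_le[OF fin(1) two] sum_sq_sum_reps_eq_diff_reps[OF fin(1)]
        sum_diffset_decomp[OF fin, of "\<lambda>n. n\<^sup>2"] card_diffset[OF fin] neg assms
      by simp
    then have sq': "(\<Sum>d\<in>?P. (?r d)\<^sup>2) + 8 * card ?P \<le> 125" by simp
    have t: "x7 - x1 \<in> ?P" using x by (intro pos_diffsI) auto
    note r1 = card_diff_reps_largest[OF x]
    obtain u where u: "u \<in> ?P" "u \<noteq> x7 - x1" "?r u \<le> 2" using ex_second_largest[OF x] by blast
    have rep: "2 \<le> ?r d" if "d \<in> ?P" "d \<noteq> x7 - x1" for d
      by (rule only_one_single[OF finP sum_r sq' t r1 u that])
    obtain v w where vw: "v \<in> ?P" "w \<in> ?P" "v \<noteq> x7 - x1" "w \<noteq> x7 - x1" "v \<noteq> w"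
      "?r v \<le> 2" "?r w \<le> 2"
      using two_further_differences[OF x rep two] by blast
    have "124 \<le> (\<Sum>d\<in>?P. (?r d)\<^sup>2) + 8 * card ?P"
      using sum_sq_tight[OF finP sum_r sq' t r1 vw(1,3,6,2,4)] vw(5,7) by simp
    \<comment> \<open>One sum with three representations already raises the left side of
      \<open>sq\<close> to 126.\<close>
    moreover have "1 \<le> card ?K"
      using ex_sum_with_three_reps[OF x rep two] fin(1) by (simp add: Suc_le_eq card_gt_0_iff)
    ultimately show False using sq by linarith
  qed
  then show ?thesis by (simp add: sumset_def diffset_def)
qed

end
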